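(* Let $K_c\subset\mathbb{E}^4$ be an unconditionally symmetric cap body of a ball. Then its illumination number satisfies $I(K_c)\le 8$. Moreover this bound is sharp: there exists an unconditionally symmetric cap body of a ball in $\mathbb{E}^4$ whose illumination number equals $8$.
   Context: Let $B^d$ be the closed unit ball of $\mathbb{E}^d$ centred at the origin. A cap body (of this ball) is $K_c=\operatorname{conv}\big(B^d\cup\{\boldsymbol v_i\mid i\in I\}\big)$ where $\{\boldsymbol v_i\mid i\in I\}$ is a countable subset of $\mathbb{E}^d\setminus B^d$ such that for any two distinct $i,j\in I$ the segment $\overline{\boldsymbol v_i\boldsymbol v_j}$ intersects $B^d$. It is unconditionally symmetric if it is symmetric with respect to each coordinate hyperplane $\{\boldsymbol x\mid x_i=0\}$, $i=1,\dots,d$ (with respect to the standard orthonormal basis). For a convex body $K$, a direction $\boldsymbol u\in\mathbb{S}^{d-1}$ illuminates a boundary point $\boldsymbol p$ of $K$ if $\boldsymbol p+\lambda\boldsymbol u$ lies in the interior of $K$ for some $\lambda>0$; the illumination number $I(K)$ is the smallest number of directions such that every boundary point of $K$ is illuminated by at least one of them. *)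

theory Defs
  imports "HOL-Analysis.Analysis"
begin

definition illuminates :: "(real^'n) set \<Rightarrow> real^'n \<Rightarrow> real^'n \<Rightarrow> bool" where
  "illuminates K u p \<longleftrightarrow> (\<exists>t>0. p + t *\<^sub>R u \<in> interior K)"

definition illumination_number :: "(real^'n) set \<Rightarrow> nat" where
  "illumination_number K = (LEAST m. \<exists>D. finite D \<and> card D = m \<and> D \<subseteq> sphere 0 1 \<and>
      (\<forall>p\<in>frontier K. \<exists>u\<in>D. illuminates K u p))"

definition cap_body :: "(real^'n) set \<Rightarrow> bool" where
  "cap_body K \<longleftrightarrow> (\<exists>V. countable V \<and> V \<inter> cball 0 1 = {} \<and>
      (\<forall>v\<in>V. \<forall>w\<in>V. v \<noteq> w \<longrightarrow> closed_segment v w \<inter> cball 0 1 \<noteq> {}) \<and>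
      K = convex hull (cball 0 1 \<union> V))"

definition coord_reflect :: "'n \<Rightarrow> real^'n \<Rightarrow> real^'n" where
  "coord_reflect i x = (\<chi> j. if j = i then - (x $ j) else x $ j)"

definition unconditionally_symmetric :: "(real^'n) set \<Rightarrow> bool" where
  "unconditionally_symmetric K \<longleftrightarrow> (\<forall>i. coord_reflect i ` K = K)"

end

theory Submission
  imports Defs
begin

text \<open>
  Write \<open>q v = v \<bullet> v - 1\<close> for a vertex \<open>v\<close> of the cap body. A direction \<open>u\<close> illuminates \<open>v\<close> as soon
  as \<open>u \<bullet> v < 0\<close> and \<open>q v * (u \<bullet> u) < (u \<bullet> v)\<^sup>2\<close>, and two vertices are compatible only if
  \<open>v \<bullet> w \<le> 1 - sqrt (q v * q w)\<close>. Unconditional symmetry applied to \<open>v\<close> and its mirror images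
  forces \<open>(v $ i)\<^sup>2 \<ge> q v\<close> for every nonzero coordinate, so the eight directions \<open>\<plusminus>e\<^sub>i\<close> only just
  fail, and only at vertices all of whose nonzero coordinates have absolute value \<open>sqrt (q v)\<close>.
  Split the coordinates into two pairs and replace the axes of each pair \<open>a, b\<close> by
  \<open>\<plusminus>(e\<^sub>a + \<epsilon> e\<^sub>b)\<close>, \<open>\<plusminus>(e\<^sub>b - \<epsilon> e\<^sub>a)\<close>: this slightly rotated cross
  illuminates every vertex with two nonzero coordinates in a common pair, and for small \<open>\<epsilon>\<close> also
  all others, except those with exactly two nonzero coordinates \<open>\<plusminus>1\<close>, one in each pair. Vertices
  of this last shape have equal or disjoint supports, so the pairing can be chosen to
  avoid them. For sharpness take the vertices \<open>\<plusminus>\<surd>2 e\<^sub>i\<close>, no two of which can be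
  illuminated by the same direction.
\<close>

section \<open>Vertices of cap bodies\<close>

text \<open>With \<open>r\<close> and \<open>s\<close> as below, the point at parameter
  \<open>t\<close> has squared norm \<open>1 + ((1 - t) * r)\<^sup>2 + (t * s)\<^sup>2 - 2 * t * (1
  - t) * (1 - v \<bullet> w)\<close>. If this is at most 1, AM-GM for the two squares gives the
  bound.\<close>

lemma segment_meets_ball_imp_inner_le:
  fixes v w :: "'a::real_inner"
  assumes v: "1 < v \<bullet> v" and w: "1 < w \<bullet> w" and seg: "closed_segment v w \<inter> cball 0 1 \<noteq> {}"
  shows "sqrt (v \<bullet> v - 1) * sqrt (w \<bullet> w - 1) \<le> 1 - v \<bullet> w"
proof -
  define r s where "r = sqrt (v \<bullet> v - 1)" and "s = sqrt (w \<bullet> w - 1)"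
  have r: "v \<bullet> v = 1 + r\<^sup>2" and s: "w \<bullet> w = 1 + s\<^sup>2"
    using v w by (auto simp: r_def s_def)
  obtain t where t: "0 \<le> t" "t \<le> 1" and n: "norm ((1 - t) *\<^sub>R v + t *\<^sub>R w) \<le> 1"
    using seg by (auto simp: closed_segment_def)
  have "((1 - t) *\<^sub>R v + t *\<^sub>R w) \<bullet> ((1 - t) *\<^sub>R v + t *\<^sub>R w) \<le> 1"
    using n by (simp add: norm_le_square)
  then have le: "(1 - t)\<^sup>2 * (1 + r\<^sup>2) + t\<^sup>2 * (1 + s\<^sup>2) + 2 * t * (1 - t) * (v \<bullet> w) \<le> 1"
    by (simp add: r s inner_commute power2_eq_square inner_add algebra_simps)
  \<comment> \<open>Both endpoints lie outside the ball; this allows cancelling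
    \<open>2 * t * (1 - t)\<close>.\<close>
  have "t \<noteq> 0" "t \<noteq> 1"
    using le v w r s by auto
  with t have pos: "0 < 2 * t * (1 - t)" by simp
  have "0 \<le> ((1 - t) * r - t * s)\<^sup>2" by simp
  with le have "2 * t * (1 - t) * (r * s) \<le> 2 * t * (1 - t) * (1 - v \<bullet> w)"
    by (simp add: power2_eq_square algebra_simps)
  with pos have "r * s \<le> 1 - v \<bullet> w"
    by (simp add: mult_le_cancel_left_pos)
  then show ?thesis by (simp add: r_def s_def)
qed

locale cap_vertices =
  fixes V :: "(real^'n) set"
  assumes outside: "V \<inter> cball 0 1 = {}"
    and segments: "\<And>v w. v \<in> V \<Longrightarrow> w \<in> V \<Longrightarrow> v \<noteq> w \<Longrightarrow> closed_segment v w \<inter> cball 0 1 \<noteq> {}"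
begin

abbreviation body :: "(real^'n) set" where
  "body \<equiv> convex hull (cball 0 1 \<union> V)"

lemma inner_self_gt_1: "v \<in> V \<Longrightarrow> 1 < v \<bullet> v"
  using outside by (auto simp: disjoint_iff norm_le_square not_le)

lemma inner_le:
  "v \<in> V \<Longrightarrow> w \<in> V \<Longrightarrow> v \<noteq> w \<Longrightarrow> sqrt (v \<bullet> v - 1) * sqrt (w \<bullet> w - 1) \<le> 1 - v \<bullet> w"
  by (intro segment_meets_ball_imp_inner_le inner_self_gt_1 segments)

text \<open>The radial projections of vertices staying away from the ball are uniformly separated.\<close>

lemma finite_vertices_away_from_ball:
  assumes "0 < \<delta>"
  shows "finite {v\<in>V. 1 + \<delta> \<le> v \<bullet> v}"
proof -
  \<comment> \<open>The cut at 1 keeps \<open>1 - c\<close> nonnegative, so that it may be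
    multiplied by \<open>norm v * norm w\<close>, which is at least 1.\<close>
  define c where "c = min \<delta> 1"
  have c: "0 < c" "c \<le> 1" "c \<le> \<delta>" using assms by (auto simp: c_def)
  let ?W = "{v\<in>V. 1 + \<delta> \<le> v \<bullet> v}"
  have sep: "2 * c \<le> (sgn v - sgn w) \<bullet> (sgn v - sgn w)"
    if "v \<in> ?W" "w \<in> ?W" "v \<noteq> w" for v w
  proof -
    have n: "1 < norm v" "1 < norm w"
      using that outside by (auto simp: disjoint_iff not_le)
    have "sqrt c * sqrt c \<le> sqrt (v \<bullet> v - 1) * sqrt (w \<bullet> w - 1)"
      using that c by (intro mult_mono) auto
    with inner_le[of v w] that c have vw: "v \<bullet> w \<le> 1 - c" by auto
    have "1 * 1 \<le> norm v * norm w"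
      using n by (intro mult_mono) auto
    then have "(1 - c) * 1 \<le> (1 - c) * (norm v * norm w)"
      using c by (intro mult_left_mono) auto
    then have "v \<bullet> w \<le> (1 - c) * (norm v * norm w)"
      using order_trans[OF vw, of "(1 - c) * (norm v * norm w)"] by simp
    moreover have "0 < norm v * norm w" using n by (intro mult_pos_pos) auto
    ultimately have "(v \<bullet> w) / (norm v * norm w) \<le> 1 - c"
      by (simp add: divide_le_eq)
    then have "sgn v \<bullet> sgn w \<le> 1 - c"
      by (simp add: sgn_div_norm divide_inverse mult_ac)
    moreover have "sgn v \<bullet> sgn v = 1" "sgn w \<bullet> sgn w = 1"
      using n by (auto simp: dot_square_norm norm_sgn)
    ultimately show ?thesis
      by (simp add: inner_diff inner_commute)
  qed
  have inj: "inj_on sgn ?W"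
  proof (rule inj_onI, rule ccontr)
    fix v w assume "v \<in> ?W" "w \<in> ?W" "sgn v = sgn w" "v \<noteq> w"
    with sep[of v w] c show False by auto
  qed
  have "uniform_discrete (sgn ` ?W)"
    unfolding uniform_discrete_def
  proof (intro exI[of _ "sqrt (2 * c)"] conjI ballI impI, rule_tac[2] ccontr)
    show "0 < sqrt (2 * c)" using c by simp
    fix x y assume xy: "x \<in> sgn ` ?W" "y \<in> sgn ` ?W" and d: "dist x y < sqrt (2 * c)" and "x \<noteq> y"
    then have "2 * c \<le> (x - y) \<bullet> (x - y)" using sep by fastforce
    then have "sqrt (2 * c) \<le> dist x y"
      by (simp add: dist_norm norm_eq_sqrt_inner)
    with d show False by simp
  qed
  moreover have "bounded (sgn ` ?W)"
    by (rule boundedI[of _ 1]) (auto simp: norm_sgn)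
  ultimately have "finite (sgn ` ?W)"
    using uniform_discrete_finite_iff by blast
  with inj show ?thesis by (simp add: finite_image_iff)
qed

text \<open>\<open>V\<close> may be infinite, but only finitely many vertices stay away from the
  ball, so \<open>V\<close> is bounded and accumulates only at the ball.\<close>

lemma compact_body: "compact body"
proof (rule compact_convex_hull)
  have "V \<subseteq> {v\<in>V. 1 + 3 \<le> v \<bullet> v} \<union> cball 0 2"
    by (auto simp: norm_le_square)
  moreover have "bounded ({v\<in>V. 1 + 3 \<le> v \<bullet> v} \<union> cball 0 2)"
    using finite_vertices_away_from_ball[of 3] by (simp add: finite_imp_bounded)
  ultimately have "bounded V" by (meson bounded_subset)
  then have bdd: "bounded (cball 0 1 \<union> V)" by simp
  have "closed (cball 0 1 \<union> V)"
    unfolding closed_def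
  proof (subst open_subopen, intro ballI)
    fix x assume "x \<in> - (cball 0 1 \<union> V)"
    then have x: "1 < x \<bullet> x" "x \<notin> V"
      by (auto simp: norm_le_square)
    define \<delta> where "\<delta> = (x \<bullet> x - 1) / 2"
    have \<delta>: "0 < \<delta>" "1 + \<delta> < x \<bullet> x" using x by (auto simp: \<delta>_def field_simps)
    \<comment> \<open>Only finitely many vertices are removed, so \<open>?U\<close> is still
      open.\<close>
    let ?U = "{y. 1 + \<delta> < y \<bullet> y} - {v\<in>V. 1 + \<delta> \<le> v \<bullet> v}"
    have "open {y::real^'n. 1 + \<delta> < y \<bullet> y}"
      by (intro open_Collect_less continuous_intros)
    then have "open ?U"
      using finite_vertices_away_from_ball[OF \<delta>(1)] by (intro open_Diff finite_imp_closed) auto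
    moreover have "x \<in> ?U" using x \<delta> by auto
    moreover have "?U \<subseteq> - (cball 0 1 \<union> V)"
      using \<delta> by (auto simp: norm_le_square)
    ultimately show "\<exists>T. open T \<and> x \<in> T \<and> T \<subseteq> - (cball 0 1 \<union> V)" by blast
  qed
  with bdd show "compact (cball 0 1 \<union> V)" by (simp add: compact_eq_bounded_closed)
qed

text \<open>The functional \<open>\<lambda>x. x \<bullet> v\<close> has its strict maximum over the
  generators at \<open>v\<close>: Cauchy-Schwarz handles the ball, and other vertices have product
  at most \<open>1 < v \<bullet> v\<close>. This recovers vertices from the body, for which alone
  symmetry is assumed.\<close>

lemma vertex_exposed:
  assumes v: "v \<in> V" and x: "x \<in> body" "v \<bullet> v \<le> x \<bullet> v"
  shows "x = v"
proof -
  let ?S = "{y. y = v \<or> y \<bullet> v < v \<bullet> v}"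
  have "convex ?S"
  proof (rule convexI)
    fix y z and s t :: real
    assume yz: "y \<in> ?S" "z \<in> ?S" and st: "0 \<le> s" "0 \<le> t" "s + t = 1"
    show "s *\<^sub>R y + t *\<^sub>R z \<in> ?S"
    proof (cases "s = 0 \<or> t = 0 \<or> (y = v \<and> z = v)")
      case True
      then show ?thesis using yz st by (auto simp flip: scaleR_add_left)
    next
      case False
      then have "s * (y \<bullet> v) + t * (z \<bullet> v) < s * (v \<bullet> v) + t * (v \<bullet> v)"
        using yz st by (auto intro: add_less_le_mono add_le_less_mono add_strict_mono)
      also have "\<dots> = v \<bullet> v" using st by (simp flip: distrib_right)
      finally show ?thesis by (simp add: inner_add_left)
    qed
  qed
  moreover have "cball 0 1 \<union> V \<subseteq> ?S"
  proof
    fix y assume "y \<in> cball 0 1 \<union> V"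
    moreover have "y \<bullet> v < v \<bullet> v" if "y \<in> cball 0 1"
    proof -
      have n: "1 < norm v" using v outside by (auto simp: disjoint_iff not_le)
      have "y \<bullet> v \<le> norm y * norm v" by (rule norm_cauchy_schwarz)
      also have "\<dots> \<le> 1 * norm v" using that by (intro mult_right_mono) auto
      also have "\<dots> < norm v * norm v" using n by (intro mult_strict_right_mono) auto
      finally show ?thesis by (simp add: dot_square_norm power2_eq_square)
    qed
    moreover have "y \<bullet> v < v \<bullet> v" if "y \<in> V" "y \<noteq> v"
    proof -
      have "0 \<le> sqrt (y \<bullet> y - 1) * sqrt (v \<bullet> v - 1)"
        using inner_self_gt_1[OF v] inner_self_gt_1[OF that(1)] by simp
      then show ?thesis
        using inner_le[OF that(1) v that(2)] inner_self_gt_1[OF v] by linarith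
    qed
    ultimately show "y \<in> ?S" by auto
  qed
  ultimately have "body \<subseteq> ?S" by (simp add: hull_minimal)
  with x show ?thesis by auto
qed

end

section \<open>Reflections in coordinate hyperplanes and symmetric vertex sets\<close>

lemma coord_reflect_nth [simp]:
  "coord_reflect i x $ j = (if j = i then - (x $ j) else x $ j)"
  by (simp add: coord_reflect_def)

lemma coord_reflect_involution [simp]: "coord_reflect i (coord_reflect i x) = x"
  by (simp add: vec_eq_iff)

lemma linear_coord_reflect: "linear (coord_reflect i)"
  by (rule linearI) (auto simp: vec_eq_iff)

lemma inner_coord_reflect: "coord_reflect i x \<bullet> coord_reflect i y = x \<bullet> y"
  unfolding inner_vec_def by (rule sum.cong) auto

lemma norm_coord_reflect [simp]: "norm (coord_reflect i x) = norm x"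
  by (simp add: norm_eq_sqrt_inner inner_coord_reflect)

lemma inner_coord_reflect_self: "x \<bullet> coord_reflect i x = x \<bullet> x - 2 * (x $ i)\<^sup>2"
proof -
  have "x \<bullet> coord_reflect i x = (\<Sum>j\<in>UNIV. x $ j * x $ j - (if j = i then 2 * (x $ i)\<^sup>2 else 0))"
    unfolding inner_vec_def by (rule sum.cong) (auto simp: power2_eq_square)
  then show ?thesis by (simp add: sum_subtractf inner_vec_def)
qed

locale unconditional_cap_vertices = cap_vertices +
  assumes symmetric: "unconditionally_symmetric body"
begin

text \<open>If the mirror image \<open>?v\<close> were not a vertex, exposedness of \<open>v\<close>
  would put every generator, hence the body, into the open half-space
  \<open>x \<bullet> ?v < v \<bullet> v\<close>. But \<open>?v\<close> belongs to the body by
  symmetry and attains equality.\<close>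

lemma coord_reflect_vertex:
  assumes v: "v \<in> V"
  shows "coord_reflect i v \<in> V"
proof (rule ccontr)
  let ?v = "coord_reflect i v"
  assume "?v \<notin> V"
  have refl: "coord_reflect i x \<in> body" if "x \<in> body" for x
    using symmetric that unfolding unconditionally_symmetric_def by blast
  have swap: "x \<bullet> ?v = coord_reflect i x \<bullet> v" for x
    by (metis coord_reflect_involution inner_coord_reflect)
  have lt: "x \<bullet> ?v < v \<bullet> v" if "x \<in> cball 0 1 \<union> V" for x
  proof (rule ccontr)
    assume "\<not> x \<bullet> ?v < v \<bullet> v"
    moreover have "coord_reflect i x \<in> body"
      using that by (intro refl hull_inc)
    ultimately have "coord_reflect i x = v"
      using vertex_exposed[OF v] by (simp add: swap)
    then have "x = ?v" by auto
    then show False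
      using that \<open>?v \<notin> V\<close> v outside by auto
  qed
  have "body \<subseteq> {x. x \<bullet> ?v < v \<bullet> v}"
    using lt by (intro hull_minimal) (auto simp: inner_commute[of _ ?v] convex_halfspace_lt)
  moreover have "?v \<in> body" using v by (intro refl hull_inc) auto
  ultimately show False by (auto simp: inner_coord_reflect)
qed

text \<open>This is \<open>inner_le\<close> for \<open>v\<close> and its mirror image, which differs
  from \<open>v\<close> since the coordinate is nonzero.\<close>

lemma nonzero_coordinate_ge:
  assumes v: "v \<in> V" and i: "v $ i \<noteq> 0"
  shows "v \<bullet> v - 1 \<le> (v $ i)\<^sup>2"
proof -
  have "coord_reflect i v \<noteq> v"
    using i by (auto simp: vec_eq_iff)
  then have "sqrt (v \<bullet> v - 1) * sqrt (v \<bullet> v - 1) \<le> 1 - (v \<bullet> v - 2 * (v $ i)\<^sup>2)"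
    using inner_le[OF v coord_reflect_vertex[OF v, of i]]
    by (simp add: inner_coord_reflect inner_coord_reflect_self)
  then show ?thesis using inner_self_gt_1[OF v] by simp
qed

end

section \<open>Illumination by a slightly rotated cross\<close>

text \<open>The point of the line through \<open>p\<close> along \<open>u\<close> nearest to the
  origin is \<open>p + s *\<^sub>R u\<close> with \<open>s\<close> as below. The hypotheses say that
  it is reached for positive \<open>s\<close> and lies in the open unit ball.\<close>

lemma illuminates_sgnI:
  assumes ball: "ball 0 1 \<subseteq> K" and neg: "u \<bullet> p < 0" and lt: "(p \<bullet> p - 1) * (u \<bullet> u) < (u \<bullet> p)\<^sup>2"
  shows "illuminates K (sgn u) p"
proof -
  have "u \<noteq> 0" using neg by auto
  then have u: "0 < u \<bullet> u" by simp
  define s where "s = - (u \<bullet> p) / (u \<bullet> u)"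
  have "0 < s" using neg u by (simp add: s_def divide_neg_pos)
  have s: "s * (u \<bullet> u) = - (u \<bullet> p)" using u by (simp add: s_def)
  have "(p + s *\<^sub>R u) \<bullet> (p + s *\<^sub>R u) = p \<bullet> p + 2 * s * (u \<bullet> p) + s * (s * (u \<bullet> u))"
    by (simp add: inner_add inner_commute algebra_simps)
  also have "\<dots> = p \<bullet> p - (u \<bullet> p)\<^sup>2 / (u \<bullet> u)"
    unfolding s by (simp add: s_def power2_eq_square)
  also have "\<dots> < 1"
    using lt u by (simp add: field_simps)
  finally have "p + s *\<^sub>R u \<in> ball 0 1" by (simp add: norm_lt_square)
  moreover have "s *\<^sub>R u = (s * norm u) *\<^sub>R sgn u"
    using \<open>u \<noteq> 0\<close> by (simp add: sgn_div_norm)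
  ultimately have "p + (s * norm u) *\<^sub>R sgn u \<in> interior K"
    using interior_maximal[OF ball open_ball] by auto
  moreover have "0 < s * norm u" using \<open>0 < s\<close> \<open>u \<noteq> 0\<close> by simp
  ultimately show ?thesis unfolding illuminates_def by blast
qed

text \<open>The homothety with centre \<open>q\<close> and ratio \<open>s\<close> keeps interior
  points interior and shrinks the displacement along \<open>u\<close> by the factor
  \<open>s\<close>.\<close>

lemma illuminates_convex_combination:
  assumes K: "convex K" and p: "illuminates K u p" and q: "q \<in> K"
    and st: "0 < s" "0 \<le> t" "s + t = 1"
  shows "illuminates K u (s *\<^sub>R p + t *\<^sub>R q)"
proof -
  obtain c where c: "0 < c" "p + c *\<^sub>R u \<in> interior K"
    using p by (auto simp: illuminates_def)
  have "q - s *\<^sub>R (q - (p + c *\<^sub>R u)) \<in> interior K"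
    using K c q st by (intro mem_interior_convex_shrink) auto
  moreover have "q - s *\<^sub>R (q - (p + c *\<^sub>R u)) = s *\<^sub>R p + t *\<^sub>R q + (s * c) *\<^sub>R u"
    using st by (simp add: algebra_simps flip: scaleR_add_left eq_diff_eq)
  ultimately show ?thesis
    using c st unfolding illuminates_def by (metis mult_pos_pos)
qed

text \<open>The illuminated points form a convex set: a direction serving \<open>x\<close> also
  serves every combination giving \<open>x\<close> positive weight. Hence only generators need
  checking.\<close>

lemma illuminates_convex_hull:
  assumes gen: "\<And>p. p \<in> S \<Longrightarrow> \<exists>u\<in>D. illuminates (convex hull S) u p" and p: "p \<in> convex hull S"
  shows "\<exists>u\<in>D. illuminates (convex hull S) u p"
proof -
  let ?K = "convex hull S"
  let ?L = "{x \<in> ?K. \<exists>u\<in>D. illuminates ?K u x}"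
  have "convex ?L"
  proof (rule convexI)
    fix x y and s t :: real
    assume xy: "x \<in> ?L" "y \<in> ?L" and st: "0 \<le> s" "0 \<le> t" "s + t = 1"
    have "s *\<^sub>R x + t *\<^sub>R y \<in> ?K"
      using xy st by (intro convexD) auto
    moreover have "\<exists>u\<in>D. illuminates ?K u (s *\<^sub>R x + t *\<^sub>R y)"
    proof (cases "s = 0")
      case True
      then show ?thesis using xy st by auto
    next
      case False
      then show ?thesis
        using xy st illuminates_convex_combination[of ?K _ x y s t] by auto
    qed
    ultimately show "s *\<^sub>R x + t *\<^sub>R y \<in> ?L" by blast
  qed
  moreover have "S \<subseteq> ?L" using gen by (auto intro: hull_inc)
  ultimately have "?K \<subseteq> ?L" by (simp add: hull_minimal)
  with p show ?thesis by auto
qed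

text \<open>The vectors are left unnormalised so that inner products with them are linear in
  \<epsilon>; \<open>sgn\<close> normalises them at the end.\<close>

definition rotated_cross :: "'n \<Rightarrow> 'n \<Rightarrow> real \<Rightarrow> (real^'n) set" where
  "rotated_cross a b \<epsilon> =
     {axis a 1 + \<epsilon> *\<^sub>R axis b 1, - (axis a 1 + \<epsilon> *\<^sub>R axis b 1),
      axis b 1 - \<epsilon> *\<^sub>R axis a 1, - (axis b 1 - \<epsilon> *\<^sub>R axis a 1)}"

lemma finite_rotated_cross [simp]: "finite (rotated_cross a b \<epsilon>)"
  by (simp add: rotated_cross_def)

lemma card_rotated_cross_le: "card (rotated_cross a b \<epsilon>) \<le> 4"
proof -
  have "card (set [w, x, y, z]) \<le> 4" for w x y z :: "real^'a"
    using card_length[of "[w, x, y, z]"] by simp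
  then show ?thesis by (simp add: rotated_cross_def)
qed

text \<open>The cross is closed under negation, so the sign of a nonzero product can be chosen
  negative.\<close>

lemma rotated_cross_directions:
  fixes v :: "real^'n"
  assumes "a \<noteq> b"
  shows "\<forall>u\<in>rotated_cross a b \<epsilon>. u \<bullet> u = 1 + \<epsilon>\<^sup>2"
    and "v $ a + \<epsilon> * v $ b \<noteq> 0 \<Longrightarrow> \<exists>u\<in>rotated_cross a b \<epsilon>. u \<bullet> v = - \<bar>v $ a + \<epsilon> * v $ b\<bar>"
    and "v $ b - \<epsilon> * v $ a \<noteq> 0 \<Longrightarrow> \<exists>u\<in>rotated_cross a b \<epsilon>. u \<bullet> v = - \<bar>v $ b - \<epsilon> * v $ a\<bar>"
proof -
  have "axis a (1::real) $ b = 0" "axis b (1::real) $ a = 0"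
    using assms by (auto simp: axis_def)
  then show "\<forall>u\<in>rotated_cross a b \<epsilon>. u \<bullet> u = 1 + \<epsilon>\<^sup>2"
    and "v $ a + \<epsilon> * v $ b \<noteq> 0 \<Longrightarrow> \<exists>u\<in>rotated_cross a b \<epsilon>. u \<bullet> v = - \<bar>v $ a + \<epsilon> * v $ b\<bar>"
    and "v $ b - \<epsilon> * v $ a \<noteq> 0 \<Longrightarrow> \<exists>u\<in>rotated_cross a b \<epsilon>. u \<bullet> v = - \<bar>v $ b - \<epsilon> * v $ a\<bar>"
    by (auto simp: rotated_cross_def inner_add inner_diff inner_axis_axis inner_axis'
        power2_eq_square abs_if)
qed

text \<open>The products with the two rotated axes arise from \<open>(v $ a, v $ b)\<close> by a
  matrix of determinant \<open>1 + \<epsilon>\<^sup>2\<close>, so they do not both vanish.\<close>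

lemma rotated_cross_illuminates_ball:
  assumes "a \<noteq> b" "v $ a \<noteq> 0 \<or> v $ b \<noteq> 0"
  shows "\<exists>u\<in>rotated_cross a b \<epsilon>. u \<bullet> v < 0"
proof -
  have "v $ a + \<epsilon> * v $ b \<noteq> 0 \<or> v $ b - \<epsilon> * v $ a \<noteq> 0"
  proof (rule ccontr)
    assume "\<not> ?thesis"
    then have ab: "v $ a = - \<epsilon> * v $ b" "v $ b = \<epsilon> * v $ a" by auto
    then have "(1 + \<epsilon>\<^sup>2) * v $ a = 0" by (simp add: algebra_simps power2_eq_square)
    moreover have "1 + \<epsilon>\<^sup>2 > 0" by (simp add: add_pos_nonneg)
    ultimately have "v $ a = 0" by simp
    with ab assms show False by simp
  qed
  then obtain x u where "x \<noteq> 0" "u \<in> rotated_cross a b \<epsilon>" "u \<bullet> v = - \<bar>x\<bar>"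
    using rotated_cross_directions(2,3)[OF assms(1), of v \<epsilon>] by blast
  then show ?thesis by (intro bexI[of _ u]) auto
qed

text \<open>For two nonzero coordinates the mixed term \<open>2 * \<epsilon> * (x * y)\<close> of
  the square supplies strictness; the sign of \<open>v $ a * v $ b\<close> decides which rotated
  axis profits. With a zero coordinate the strict margin is assumed.\<close>

lemma rotated_cross_illuminates_vertex:
  assumes ab: "a \<noteq> b" and \<epsilon>: "0 < \<epsilon>" and q: "0 < q"
    and v: "v $ a \<noteq> 0 \<and> v $ b \<noteq> 0 \<and> q \<le> (v $ a)\<^sup>2 \<and> q \<le> (v $ b)\<^sup>2 \<or>
      v $ b = 0 \<and> q * (1 + \<epsilon>\<^sup>2) < (v $ a)\<^sup>2 \<or> v $ a = 0 \<and> q * (1 + \<epsilon>\<^sup>2) < (v $ b)\<^sup>2"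
  shows "\<exists>u\<in>rotated_cross a b \<epsilon>. u \<bullet> v < 0 \<and> q * (u \<bullet> u) < (u \<bullet> v)\<^sup>2"
proof -
  have *: "q * (1 + \<epsilon>\<^sup>2) < (x + \<epsilon> * y)\<^sup>2" if "0 < x * y" "q \<le> x\<^sup>2" "q \<le> y\<^sup>2" for x y
  proof -
    have "q * (1 + \<epsilon>\<^sup>2) \<le> x\<^sup>2 + \<epsilon>\<^sup>2 * y\<^sup>2"
      using that mult_left_mono[of q "y\<^sup>2" "\<epsilon>\<^sup>2"] by (simp add: algebra_simps)
    also have "\<dots> < x\<^sup>2 + \<epsilon>\<^sup>2 * y\<^sup>2 + 2 * \<epsilon> * (x * y)" using that \<epsilon> by simp
    finally show ?thesis by (simp add: power2_eq_square algebra_simps)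
  qed
  have "0 < q * (1 + \<epsilon>\<^sup>2)" using q by (simp add: add_pos_nonneg)
  consider "q * (1 + \<epsilon>\<^sup>2) < (v $ a + \<epsilon> * v $ b)\<^sup>2" | "q * (1 + \<epsilon>\<^sup>2) < (v $ b - \<epsilon> * v $ a)\<^sup>2"
  proof -
    consider "0 < v $ a * v $ b" | "v $ a * v $ b < 0" | "v $ b = 0" | "v $ a = 0"
      by (metis linorder_cases mult_eq_0_iff)
    then show thesis
    proof cases
      case 1
      with v have "q \<le> (v $ a)\<^sup>2" "q \<le> (v $ b)\<^sup>2" by auto
      with *[OF 1] show ?thesis using that by blast
    next
      case 2
      with v have "q \<le> (v $ a)\<^sup>2" "q \<le> (v $ b)\<^sup>2" by auto
      with *[of "v $ b" "- (v $ a)"] 2 show ?thesis using that by (simp add: mult.commute)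
    next
      case 3
      with v q that \<open>0 < q * (1 + \<epsilon>\<^sup>2)\<close> show ?thesis by auto
    next
      case 4
      with v q that \<open>0 < q * (1 + \<epsilon>\<^sup>2)\<close> show ?thesis by auto
    qed
  qed
  then show ?thesis
  proof cases
    case 1
    then have nz: "v $ a + \<epsilon> * v $ b \<noteq> 0" using \<open>0 < q * (1 + \<epsilon>\<^sup>2)\<close> by auto
    then obtain u where u: "u \<in> rotated_cross a b \<epsilon>" "u \<bullet> v = - \<bar>v $ a + \<epsilon> * v $ b\<bar>"
      using rotated_cross_directions(2)[OF ab nz] by blast
    then have "u \<bullet> u = 1 + \<epsilon>\<^sup>2" using rotated_cross_directions(1)[OF ab] by blast
    with u 1 nz show ?thesis by (intro bexI[of _ u]) auto
  next
    case 2
    then have nz: "v $ b - \<epsilon> * v $ a \<noteq> 0" using \<open>0 < q * (1 + \<epsilon>\<^sup>2)\<close> by auto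
    then obtain u where u: "u \<in> rotated_cross a b \<epsilon>" "u \<bullet> v = - \<bar>v $ b - \<epsilon> * v $ a\<bar>"
      using rotated_cross_directions(3)[OF ab nz] by blast
    then have "u \<bullet> u = 1 + \<epsilon>\<^sup>2" using rotated_cross_directions(1)[OF ab] by blast
    with u 2 nz show ?thesis by (intro bexI[of _ u]) auto
  qed
qed

text \<open>The first bound serves vertices with one nonzero coordinate, the second those with two.
  Each holds for a fixed vertex once \<epsilon> is small; finiteness away from the ball makes the
  choice uniform.\<close>

lemma (in cap_vertices) rotation_parameter_exists:
  obtains \<epsilon> :: real where "0 < \<epsilon>"
    and "\<And>v. v \<in> V \<Longrightarrow> (v \<bullet> v - 1) * \<epsilon>\<^sup>2 < 1"
    and "\<And>v. v \<in> V \<Longrightarrow> v \<bullet> v - 1 < 1 \<Longrightarrow> (v \<bullet> v - 1) * (1 + 2 * \<epsilon>\<^sup>2) < 1"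
proof -
  let ?good = "\<lambda>v \<epsilon>. (v \<bullet> v - 1) * \<epsilon>\<^sup>2 < 1 \<and>
    (v \<bullet> v - 1 < 1 \<longrightarrow> (v \<bullet> v - 1) * (1 + 2 * \<epsilon>\<^sup>2) < 1)"
  \<comment> \<open>For vertices outside \<open>?W\<close>, any \<epsilon> below 1 works: then
    \<open>1 + 2 * \<epsilon>\<^sup>2\<close> is below 3 and the product below 3/4.\<close>
  let ?W = "{v\<in>V. 1 + 1/4 \<le> v \<bullet> v}"
  have "\<forall>\<^sub>F \<epsilon> in at_right 0. ?good v \<epsilon>" for v :: "real^'n"
  proof -
    have "((\<lambda>\<epsilon>. (v \<bullet> v - 1) * \<epsilon>\<^sup>2) \<longlongrightarrow> (v \<bullet> v - 1) * 0\<^sup>2) (at_right (0::real))"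
      by (intro tendsto_intros)
    then have *: "\<forall>\<^sub>F \<epsilon> in at_right (0::real). (v \<bullet> v - 1) * \<epsilon>\<^sup>2 < 1"
      by (rule order_tendstoD) simp
    have "((\<lambda>\<epsilon>. (v \<bullet> v - 1) * (1 + 2 * \<epsilon>\<^sup>2)) \<longlongrightarrow> (v \<bullet> v - 1) * (1 + 2 * 0\<^sup>2)) (at_right (0::real))"
      by (intro tendsto_intros)
    then have "\<forall>\<^sub>F \<epsilon> in at_right (0::real). (v \<bullet> v - 1) * (1 + 2 * \<epsilon>\<^sup>2) < 1" if "v \<bullet> v - 1 < 1"
      by (rule order_tendstoD) (use that in simp)
    then have "\<forall>\<^sub>F \<epsilon> in at_right (0::real). v \<bullet> v - 1 < 1 \<longrightarrow> (v \<bullet> v - 1) * (1 + 2 * \<epsilon>\<^sup>2) < 1"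
      by (cases "v \<bullet> v - 1 < 1") simp_all
    with * show ?thesis by (rule eventually_conj)
  qed
  then have "\<forall>\<^sub>F \<epsilon> in at_right 0. \<forall>v\<in>?W. ?good v \<epsilon>"
    using finite_vertices_away_from_ball[of "1/4"] by (intro eventually_ball_finite) auto
  moreover have "\<forall>\<^sub>F \<epsilon> in at_right (0::real). 0 < \<epsilon> \<and> \<epsilon> < 1"
    unfolding eventually_at_right_field by (intro exI[of _ 1]) auto
  ultimately have "\<forall>\<^sub>F \<epsilon> in at_right (0::real). (\<forall>v\<in>?W. ?good v \<epsilon>) \<and> 0 < \<epsilon> \<and> \<epsilon> < 1"
    by (rule eventually_conj)
  then obtain \<epsilon> :: real where \<epsilon>: "\<forall>v\<in>?W. ?good v \<epsilon>" "0 < \<epsilon>" "\<epsilon> < 1"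
    using eventually_happens'[OF trivial_limit_at_right_real] by blast
  have small: "?good v \<epsilon>" if "v \<in> V" "v \<notin> ?W" for v
  proof -
    have q: "0 < v \<bullet> v - 1" "v \<bullet> v - 1 < 1/4"
      using that inner_self_gt_1[of v] by auto
    have e: "\<epsilon>\<^sup>2 < 1" using \<epsilon> by (simp add: power_less_one_iff)
    have "(v \<bullet> v - 1) * \<epsilon>\<^sup>2 < 1/4 * 1"
      using q e by (intro mult_strict_mono) auto
    with q show ?thesis by (simp add: algebra_simps)
  qed
  show ?thesis
    using that[of \<epsilon>] \<epsilon> small by blast
qed

section \<open>Dimension four\<close>

lemma inner_self_four:
  fixes v :: "real^'n"
  assumes "distinct [a, b, c, d]" "UNIV = {a, b, c, d}"
  shows "v \<bullet> v = (v $ a)\<^sup>2 + (v $ b)\<^sup>2 + (v $ c)\<^sup>2 + (v $ d)\<^sup>2"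
proof -
  have "v \<bullet> v = (\<Sum>i\<in>{a, b, c, d}. v $ i * v $ i)"
    unfolding assms(2)[symmetric] by (simp add: inner_vec_def)
  then show ?thesis using assms(1) by (simp add: power2_eq_square)
qed

lemma UNIV_4_complete_pair:
  fixes a b :: 4
  assumes "a \<noteq> b"
  obtains c d where "distinct [a, b, c, d]" "UNIV = {a, b, c, d}"
proof -
  have "card (- {a, b}) = 2"
    using assms by (simp add: Compl_eq_Diff_UNIV card_Diff_subset)
  then obtain c d where cd: "- {a, b} = {c, d}" "c \<noteq> d"
    by (auto simp: card_2_iff)
  then have "UNIV = {a, b, c, d}" "distinct [a, b, c, d]"
    using assms by auto
  with that show thesis by blast
qed

section \<open>Exceptional vertices and the pairing of the axes\<close>

locale unconditional_cap_vertices_4 = unconditional_cap_vertices V for V :: "(real^4) set"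
begin

text \<open>For distinct \<open>i\<close> and \<open>j\<close>, squared norm 2 forces the other
  coordinates to vanish: these are the exceptional vertices with two entries of absolute value
  1.\<close>

definition unit_pair :: "4 \<Rightarrow> 4 \<Rightarrow> bool" where
  "unit_pair i j \<longleftrightarrow> (\<exists>v\<in>V. (v $ i)\<^sup>2 = 1 \<and> (v $ j)\<^sup>2 = 1 \<and> v \<bullet> v = 2)"

text \<open>Two exceptional vertices sharing just the index \<open>i\<close> can be reflected to
  agree there. Their inner product is then 1, whereas compatibility at squared norm 2 requires at
  most 0.\<close>

lemma unit_pair_same_partner:
  assumes ij: "unit_pair i j" and ik: "unit_pair i k" and ne: "i \<noteq> j" "i \<noteq> k"
  shows "j = k"
proof (rule ccontr)
  assume "j \<noteq> k"
  obtain v where v: "v \<in> V" "(v $ i)\<^sup>2 = 1" "(v $ j)\<^sup>2 = 1" "v \<bullet> v = 2"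
    using ij by (auto simp: unit_pair_def)
  obtain w0 where w0: "w0 \<in> V" "(w0 $ i)\<^sup>2 = 1" "(w0 $ k)\<^sup>2 = 1" "w0 \<bullet> w0 = 2"
    using ik by (auto simp: unit_pair_def)
  define w where "w = (if w0 $ i = v $ i then w0 else coord_reflect i w0)"
  have w: "w \<in> V" "(w $ k)\<^sup>2 = 1" "w \<bullet> w = 2" "w $ i = v $ i"
    using w0 ne v by (auto simp: w_def coord_reflect_vertex inner_coord_reflect power2_eq_1_iff)
  obtain l where l: "distinct [i, j, k, l]" "UNIV = {i, j, k, l}"
  proof -
    obtain c d where "distinct [i, j, c, d]" "UNIV = {i, j, c, d}"
      using UNIV_4_complete_pair[OF ne(1)] .
    moreover have "k = c \<or> k = d" using calculation \<open>j \<noteq> k\<close> ne by (metis UNIV_I insertE singletonD)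
    ultimately show thesis using that[of c] that[of d] by auto
  qed
  have zero: "v $ k = 0" "v $ l = 0" "w $ j = 0" "w $ l = 0"
    using inner_self_four[OF l, of v] inner_self_four[OF l, of w] v w
    by (auto simp: sum_power2_eq_zero_iff)
  have "v \<bullet> w = (\<Sum>m\<in>{i, j, k, l}. v $ m * w $ m)"
    unfolding l(2)[symmetric] by (simp add: inner_vec_def)
  then have "v \<bullet> w = (v $ i)\<^sup>2"
    using l(1) zero w by (simp add: power2_eq_square)
  moreover have "v \<noteq> w" using zero w by auto
  ultimately show False
    using inner_le[OF v(1) w(1)] v w by simp
qed

text \<open>An exceptional support, if there is one, becomes the first pair, since its indices have
  no further partners. Otherwise any pairing works.\<close>

lemma pairing_exists:
  obtains a b c d where "distinct [a, b, c, d]" "UNIV = {a, b, c, d}"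
    and "\<not> unit_pair a c" "\<not> unit_pair a d" "\<not> unit_pair b c" "\<not> unit_pair b d"
proof (cases "\<exists>i j. i \<noteq> j \<and> unit_pair i j")
  case True
  then obtain a b where ab: "a \<noteq> b" "unit_pair a b" by blast
  obtain c d where cd: "distinct [a, b, c, d]" "UNIV = {a, b, c, d}"
    using UNIV_4_complete_pair[OF ab(1)] .
  have ba: "unit_pair b a" using ab(2) by (auto simp: unit_pair_def)
  show ?thesis
    using that[OF cd] unit_pair_same_partner[OF ab(2)] unit_pair_same_partner[OF ba] cd(1)
    by auto
next
  case False
  obtain c d where cd: "distinct [1::4, 2, c, d]" "UNIV = {1, 2, c, d}"
    using UNIV_4_complete_pair[of 1 2] by auto
  have "\<not> unit_pair i j" if "i \<noteq> j" for i j using False that by blast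
  with cd(1) show ?thesis by (intro that[OF cd]) auto
qed

text \<open>Two rotated crosses give at most eight directions; by
  \<open>illuminates_convex_hull\<close> it suffices to treat the vertices and the points of the
  ball.\<close>

lemma illuminating_directions_exist:
  "\<exists>D. finite D \<and> card D \<le> 8 \<and> D \<subseteq> sphere 0 1 \<and> (\<forall>p\<in>frontier body. \<exists>u\<in>D. illuminates body u p)"
proof -
  obtain a b c d where abcd: "distinct [a, b, c, d]" "UNIV = {a, b, c, d}"
    and cross: "\<not> unit_pair a c" "\<not> unit_pair a d" "\<not> unit_pair b c" "\<not> unit_pair b d"
    using pairing_exists .
  obtain \<epsilon> :: real where \<epsilon>: "0 < \<epsilon>"
    and axis_bound: "\<And>v. v \<in> V \<Longrightarrow> (v \<bullet> v - 1) * \<epsilon>\<^sup>2 < 1"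
    and cross_bound: "\<And>v. v \<in> V \<Longrightarrow> v \<bullet> v - 1 < 1 \<Longrightarrow> (v \<bullet> v - 1) * (1 + 2 * \<epsilon>\<^sup>2) < 1"
    using rotation_parameter_exists by blast
  define E where "E = rotated_cross a b \<epsilon> \<union> rotated_cross c d \<epsilon>"
  have ne: "a \<noteq> b" "c \<noteq> d" using abcd by auto
  have ball: "ball 0 1 \<subseteq> body"
    using ball_subset_cball hull_subset[of "cball 0 1 \<union> V" convex] by blast
  \<comment> \<open>The larger of \<open>x\<close> and \<open>y\<close> is at least
    \<open>(1 + q) / 2\<close>, which exceeds \<open>q * (1 + \<epsilon>\<^sup>2)\<close> by the
    second assumption.\<close>
  have large: "q * (1 + \<epsilon>\<^sup>2) < x \<or> q * (1 + \<epsilon>\<^sup>2) < y"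
    if "x + y = 1 + q" "q * (1 + 2 * \<epsilon>\<^sup>2) < 1" for x y q
    using that by (auto simp: algebra_simps)
  have vertex: "\<exists>u\<in>E. u \<bullet> v < 0 \<and> (v \<bullet> v - 1) * (u \<bullet> u) < (u \<bullet> v)\<^sup>2" if v: "v \<in> V" for v
  proof -
    define q where "q = v \<bullet> v - 1"
    have q: "0 < q" using inner_self_gt_1[OF v] by (simp add: q_def)
    have ge: "q \<le> (v $ i)\<^sup>2" if "v $ i \<noteq> 0" for i
      using nonzero_coordinate_ge[OF v that] by (simp add: q_def)
    have sum: "(v $ a)\<^sup>2 + (v $ b)\<^sup>2 + (v $ c)\<^sup>2 + (v $ d)\<^sup>2 = 1 + q"
      using inner_self_four[OF abcd, of v] by (simp add: q_def)
    have two: "q * (1 + \<epsilon>\<^sup>2) < (v $ i)\<^sup>2 \<or> q * (1 + \<epsilon>\<^sup>2) < (v $ j)\<^sup>2"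
      if ij: "(v $ i)\<^sup>2 + (v $ j)\<^sup>2 = 1 + q" "\<not> unit_pair i j" for i j
    proof (cases "v $ i = 0 \<or> v $ j = 0")
      case True
      then show ?thesis using ij axis_bound[OF v] by (auto simp: q_def algebra_simps)
    next
      case False
      then have le: "q \<le> (v $ i)\<^sup>2" "q \<le> (v $ j)\<^sup>2" using ge by auto
      \<comment> \<open>Two squares that are at least \<open>q\<close> and sum to
        \<open>1 + q\<close> force \<open>q \<le> 1\<close>; equality would make \<open>i\<close>,
        \<open>j\<close> a unit pair.\<close>
      have "q \<noteq> 1"
      proof
        assume "q = 1"
        with le ij(1) have "(v $ i)\<^sup>2 = 1" "(v $ j)\<^sup>2 = 1" by auto
        with v ij(2) \<open>q = 1\<close> show False by (auto simp: unit_pair_def q_def)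
      qed
      with le ij(1) have "q < 1" by linarith
      then show ?thesis
        using large[OF ij(1)] cross_bound[OF v] by (simp add: q_def)
    qed
    \<comment> \<open>If neither pair has two nonzero coordinates, one index from each pair carries
      the whole sum and \<open>two\<close> applies to them.\<close>
    have "v $ a \<noteq> 0 \<and> v $ b \<noteq> 0 \<or> v $ b = 0 \<and> q * (1 + \<epsilon>\<^sup>2) < (v $ a)\<^sup>2 \<or>
        v $ a = 0 \<and> q * (1 + \<epsilon>\<^sup>2) < (v $ b)\<^sup>2 \<or>
        v $ c \<noteq> 0 \<and> v $ d \<noteq> 0 \<or> v $ d = 0 \<and> q * (1 + \<epsilon>\<^sup>2) < (v $ c)\<^sup>2 \<or>
        v $ c = 0 \<and> q * (1 + \<epsilon>\<^sup>2) < (v $ d)\<^sup>2"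
      using two[of a c] two[of a d] two[of b c] two[of b d] cross sum by fastforce
    then have "(\<exists>u\<in>rotated_cross a b \<epsilon>. u \<bullet> v < 0 \<and> q * (u \<bullet> u) < (u \<bullet> v)\<^sup>2) \<or>
        (\<exists>u\<in>rotated_cross c d \<epsilon>. u \<bullet> v < 0 \<and> q * (u \<bullet> u) < (u \<bullet> v)\<^sup>2)"
      using rotated_cross_illuminates_vertex[OF ne(1) \<epsilon> q, of v]
        rotated_cross_illuminates_vertex[OF ne(2) \<epsilon> q, of v] ge by blast
    then show ?thesis by (auto simp: E_def q_def)
  qed
  have unit: "sgn ` E \<subseteq> sphere 0 1"
  proof -
    have "u \<noteq> 0" if "u \<in> E" for u
    proof -
      have "u \<bullet> u = 1 + \<epsilon>\<^sup>2"
        using that rotated_cross_directions(1) ne by (auto simp: E_def)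
      then show ?thesis by (auto simp: add_nonneg_eq_0_iff)
    qed
    then show ?thesis by (auto simp: norm_sgn)
  qed
  have "\<exists>u\<in>sgn ` E. illuminates body u p" if p: "p \<in> cball 0 1 \<union> V" for p
  proof -
    consider "p \<in> V" | "p = 0" | "p \<in> cball 0 1" "p \<noteq> 0" using p by blast
    then show ?thesis
    proof cases
      case 1
      then show ?thesis using vertex illuminates_sgnI[OF ball] by blast
    next
      \<comment> \<open>No direction has negative product with the origin, but the origin is
        interior, so any direction serves.\<close>
      case 2
      obtain u where u: "u \<in> E" by (auto simp: E_def rotated_cross_def)
      then have "norm (sgn u) = 1" using unit by auto
      then have "(1/2) *\<^sub>R sgn u \<in> ball 0 1" by simp
      then have "p + (1/2) *\<^sub>R sgn u \<in> interior body"
        using interior_maximal[OF ball open_ball] 2 by auto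
      then have "illuminates body (sgn u) p"
        unfolding illuminates_def by (intro exI[of _ "1/2"]) auto
      with u show ?thesis by blast
    next
      case 3
      then obtain i where "p $ i \<noteq> 0" by (auto simp: vec_eq_iff)
      moreover have "i \<in> {a, b, c, d}" using abcd(2) by blast
      ultimately have "\<exists>u\<in>E. u \<bullet> p < 0"
        using rotated_cross_illuminates_ball[OF ne(1), of p \<epsilon>]
          rotated_cross_illuminates_ball[OF ne(2), of p \<epsilon>] by (auto simp: E_def)
      then obtain u where u: "u \<in> E" "u \<bullet> p < 0" by blast
      \<comment> \<open>In the ball the quadratic condition follows from a negative product
        alone.\<close>
      have "p \<bullet> p - 1 \<le> 0" using 3 by (simp add: norm_le_square)
      then have "(p \<bullet> p - 1) * (u \<bullet> u) \<le> 0"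
        by (simp add: mult_nonpos_nonneg)
      also have "0 < (u \<bullet> p)\<^sup>2" using u by simp
      finally show ?thesis using illuminates_sgnI[OF ball u(2)] u(1) by blast
    qed
  qed
  then have "\<forall>p\<in>body. \<exists>u\<in>sgn ` E. illuminates body u p"
    using illuminates_convex_hull by blast
  moreover have "frontier body \<subseteq> body"
    using compact_body by (simp add: compact_imp_closed frontier_subset_closed)
  moreover have "finite (sgn ` E)" by (simp add: E_def)
  moreover have "card (sgn ` E) \<le> 8"
  proof -
    have "card (sgn ` E) \<le> card E" by (rule card_image_le) (simp add: E_def)
    also have "\<dots> \<le> card (rotated_cross a b \<epsilon>) + card (rotated_cross c d \<epsilon>)"
      unfolding E_def by (rule card_Un_le)
    also have "\<dots> \<le> 8"
      using card_rotated_cross_le[of a b \<epsilon>] card_rotated_cross_le[of c d \<epsilon>] by simp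
    finally show ?thesis .
  qed
  ultimately show ?thesis using unit by blast
qed

end

section \<open>From illuminating sets to the illumination number\<close>

lemma unconditional_cap_body_illuminated:
  fixes K :: "(real^4) set"
  assumes "cap_body K" "unconditionally_symmetric K"
  obtains D where "finite D" "card D \<le> 8" "D \<subseteq> sphere 0 1"
    "\<forall>p\<in>frontier K. \<exists>u\<in>D. illuminates K u p"
proof -
  obtain V where "V \<inter> cball 0 1 = {}"
    "\<forall>v\<in>V. \<forall>w\<in>V. v \<noteq> w \<longrightarrow> closed_segment v w \<inter> cball 0 1 \<noteq> {}"
    and K: "K = convex hull (cball 0 1 \<union> V)"
    using assms(1) by (auto simp: cap_body_def)
  then interpret unconditional_cap_vertices_4 V
    using assms(2) by unfold_locales auto
  show thesis using illuminating_directions_exist that K by auto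
qed

lemma illumination_number_le:
  assumes "finite D" "D \<subseteq> sphere 0 1" "\<forall>p\<in>frontier K. \<exists>u\<in>D. illuminates K u p"
  shows "illumination_number K \<le> card D"
  unfolding illumination_number_def by (rule Least_le, rule exI[of _ D]) (use assms in simp)

text \<open>The given \<open>D\<close> shows that \<open>LEAST\<close> ranges over a nonempty set,
  so the minimum is attained.\<close>

lemma illumination_number_attained:
  assumes "finite D" "D \<subseteq> sphere 0 1" "\<forall>p\<in>frontier K. \<exists>u\<in>D. illuminates K u p"
  obtains D' where "finite D'" "card D' = illumination_number K" "D' \<subseteq> sphere 0 1"
    "\<forall>p\<in>frontier K. \<exists>u\<in>D'. illuminates K u p"
proof -
  have "\<exists>D'. finite D' \<and> card D' = illumination_number K \<and> D' \<subseteq> sphere 0 1 \<and>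
      (\<forall>p\<in>frontier K. \<exists>u\<in>D'. illuminates K u p)"
    unfolding illumination_number_def by (rule LeastI[of _ "card D"], rule exI[of _ D]) (use assms in simp)
  with that show thesis by blast
qed

section \<open>Sharpness\<close>

text \<open>With length \<open>sqrt 2\<close>, segments between vertices on different axes just
  touch the ball, at their midpoints.\<close>

definition cross_vertices :: "(real^'n) set" where
  "cross_vertices = {axis i s | i s. s\<^sup>2 = 2}"

abbreviation cross_cap_body :: "(real^'n) set" where
  "cross_cap_body \<equiv> convex hull (cball 0 1 \<union> cross_vertices)"

lemma inner_self_cross_vertex: "v \<in> cross_vertices \<Longrightarrow> v \<bullet> v = 2"
  by (auto simp: cross_vertices_def inner_axis_axis power2_eq_square)

lemma inner_cross_vertices_le:
  "v \<in> cross_vertices \<Longrightarrow> w \<in> cross_vertices \<Longrightarrow> v \<noteq> w \<Longrightarrow> v \<bullet> w \<le> 0"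
proof (clarsimp simp: cross_vertices_def inner_axis_axis)
  fix i and s t :: real
  assume "s\<^sup>2 = 2" "t\<^sup>2 = 2" "(axis i s :: real^'n) \<noteq> axis i t"
  then have "s = - t" by (metis power2_eq_iff)
  with \<open>t\<^sup>2 = 2\<close> show "s * t \<le> 0" by (simp add: power2_eq_square)
qed

lemma finite_cross_vertices: "finite (cross_vertices :: (real^'n) set)"
  and card_cross_vertices: "card (cross_vertices :: (real^'n) set) = 2 * CARD('n)"
proof -
  let ?f = "\<lambda>(i, s). axis i s :: real^'n"
  let ?A = "UNIV \<times> {sqrt 2, - sqrt 2} :: ('n \<times> real) set"
  have "s\<^sup>2 = 2 \<longleftrightarrow> s = sqrt 2 \<or> s = - sqrt 2" for s :: real
    using power2_eq_iff[of s "sqrt 2"] by simp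
  then have img: "cross_vertices = ?f ` ?A"
    by (auto simp: cross_vertices_def)
  have inj: "inj_on ?f ?A"
    by (rule inj_onI) (auto simp: axis_eq_axis)
  show "finite (cross_vertices :: (real^'n) set)" by (simp add: img)
  show "card (cross_vertices :: (real^'n) set) = 2 * CARD('n)"
    unfolding img card_image[OF inj] by (simp add: card_cartesian_product)
qed

lemma cap_body_cross: "cap_body cross_cap_body"
  unfolding cap_body_def
proof (intro exI[of _ cross_vertices] conjI ballI impI)
  show "countable cross_vertices"
    by (simp add: countable_finite finite_cross_vertices)
  show "cross_vertices \<inter> cball 0 1 = {}"
    using inner_self_cross_vertex by (fastforce simp: norm_le_square)
  fix v w :: "real^'n"
  assume vw: "v \<in> cross_vertices" "w \<in> cross_vertices" "v \<noteq> w"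
  have "(midpoint v w) \<bullet> (midpoint v w) \<le> 1"
    using inner_cross_vertices_le[OF vw] vw(1,2)
    by (simp add: midpoint_def inner_add inner_commute inner_self_cross_vertex)
  then have "midpoint v w \<in> cball 0 1"
    by (simp add: norm_le_square)
  then show "closed_segment v w \<inter> cball 0 1 \<noteq> {}"
    using midpoint_in_closed_segment by blast
qed simp

lemma unconditionally_symmetric_cross: "unconditionally_symmetric cross_cap_body"
proof -
  let ?S = "cball 0 1 \<union> cross_vertices :: (real^'n) set"
  have mem: "coord_reflect i x \<in> ?S" if "x \<in> ?S" for i x
    using that
  proof
    assume "x \<in> cross_vertices"
    then obtain j s where x: "x = axis j s" "s\<^sup>2 = 2" by (auto simp: cross_vertices_def)
    have "coord_reflect i x = axis j (if j = i then - s else s)"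
      by (auto simp: x vec_eq_iff axis_def)
    moreover have "(if j = i then - s else s)\<^sup>2 = 2" using x by simp
    ultimately show ?thesis unfolding cross_vertices_def by blast
  qed simp
  have "coord_reflect i ` ?S = ?S" for i
  proof
    show "?S \<subseteq> coord_reflect i ` ?S"
      using mem by (metis coord_reflect_involution image_eqI subsetI)
  qed (use mem in blast)
  then show ?thesis
    unfolding unconditionally_symmetric_def
    by (metis convex_hull_linear_image linear_coord_reflect)
qed

text \<open>The left side is convex in \<open>x\<close> and at most \<open>sqrt 2\<close> on all
  generators. Its sublevel set is a double cone with apexes at the two vertices on axis
  \<open>i\<close>.\<close>

lemma cross_cap_body_bound:
  fixes x :: "real^'n"
  assumes "x \<in> cross_cap_body"
  shows "\<bar>x $ i\<bar> + norm (x - axis i (x $ i)) \<le> sqrt 2"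
proof -
  define f where "f x = \<bar>x $ i\<bar> + norm (x - axis i (x $ i))" for x :: "real^'n"
  have split: "(norm x)\<^sup>2 = (x $ i)\<^sup>2 + (norm (x - axis i (x $ i)))\<^sup>2" for x :: "real^'n"
    unfolding power2_norm_eq_inner
    by (simp add: inner_diff inner_axis inner_axis' inner_axis_axis power2_eq_square)
  have "f y \<le> sqrt 2" if "y \<in> cball 0 1 \<union> cross_vertices" for y
    using that
  proof
    assume "y \<in> cball 0 1"
    then have "(norm y)\<^sup>2 \<le> 1" by (simp add: power_le_one)
    with split[of y] have "\<bar>y $ i\<bar>\<^sup>2 + (norm (y - axis i (y $ i)))\<^sup>2 \<le> 1" by simp
    moreover have "(p + q)\<^sup>2 \<le> 2" if "p\<^sup>2 + q\<^sup>2 \<le> 1" for p q :: real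
      using sum_squares_bound[of p q] that by (simp add: power2_sum)
    ultimately show ?thesis unfolding f_def by (intro real_le_rsqrt) blast
  next
    assume "y \<in> cross_vertices"
    then obtain j s where y: "y = axis j s" "s\<^sup>2 = 2" by (auto simp: cross_vertices_def)
    then have s: "\<bar>s\<bar> = sqrt 2" by (metis real_sqrt_abs)
    show ?thesis
    proof (cases "i = j")
      case True
      then show ?thesis using s by (simp add: f_def y axis_def)
    next
      case False
      then have "y $ i = 0" "y - axis i (y $ i) = y"
        by (auto simp: y vec_eq_iff axis_def)
      then have "f y = norm y" unfolding f_def by (metis abs_zero add_0)
      moreover have "norm y = \<bar>s\<bar>" by (simp add: y norm_eq_sqrt_inner inner_axis_axis)
      ultimately show ?thesis using s by simp
    qed
  qed
  moreover have "convex {y. f y \<le> sqrt 2}"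
  proof (rule convexI, clarify)
    fix y z and s t :: real
    assume yz: "f y \<le> sqrt 2" "f z \<le> sqrt 2" and st: "0 \<le> s" "0 \<le> t" "s + t = 1"
    have lin: "s *\<^sub>R y + t *\<^sub>R z - axis i ((s *\<^sub>R y + t *\<^sub>R z) $ i) =
        s *\<^sub>R (y - axis i (y $ i)) + t *\<^sub>R (z - axis i (z $ i))"
      by (simp add: vec_eq_iff axis_def algebra_simps)
    have "f (s *\<^sub>R y + t *\<^sub>R z) \<le> s * f y + t * f z"
    proof -
      have "\<bar>(s *\<^sub>R y + t *\<^sub>R z) $ i\<bar> \<le> s * \<bar>y $ i\<bar> + t * \<bar>z $ i\<bar>"
        using abs_triangle_ineq[of "s * y $ i" "t * z $ i"] st by (simp add: abs_mult)
      moreover have "norm (s *\<^sub>R y + t *\<^sub>R z - axis i ((s *\<^sub>R y + t *\<^sub>R z) $ i)) \<le>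
          s * norm (y - axis i (y $ i)) + t * norm (z - axis i (z $ i))"
        unfolding lin using norm_triangle_ineq[of "s *\<^sub>R (y - axis i (y $ i))" "t *\<^sub>R (z - axis i (z $ i))"] st
        by simp
      ultimately show ?thesis by (simp add: f_def algebra_simps)
    qed
    also have "\<dots> \<le> sqrt 2" using convex_bound_le[OF yz st] .
    finally show "f (s *\<^sub>R y + t *\<^sub>R z) \<le> sqrt 2" .
  qed
  ultimately have "cross_cap_body \<subseteq> {y. f y \<le> sqrt 2}" by (intro hull_minimal) auto
  with assms show ?thesis by (auto simp: f_def)
qed

text \<open>An interior point can be stretched by some \<open>1 + c > 1\<close> within the body, and
  the bounded function is positively homogeneous.\<close>

lemma interior_cross_cap_body_bound:
  fixes x :: "real^'n"
  assumes "x \<in> interior cross_cap_body"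
  shows "\<bar>x $ i\<bar> + norm (x - axis i (x $ i)) < sqrt 2"
proof -
  let ?f = "\<lambda>x::real^'n. \<bar>x $ i\<bar> + norm (x - axis i (x $ i))"
  obtain e where e: "0 < e" "cball x e \<subseteq> cross_cap_body"
    using assms by (auto simp: mem_interior_cball)
  \<comment> \<open>Stretching moves \<open>x\<close> by \<open>c * norm x\<close>, at most
    \<open>e\<close>; the added 1 covers \<open>x = 0\<close>.\<close>
  define c where "c = e / (norm x + 1)"
  have "0 < norm x + 1" by (simp add: add_nonneg_pos)
  then have c: "0 < c" "c * norm x \<le> e"
    using e by (auto simp: c_def pos_divide_le_eq)
  then have "(1 + c) *\<^sub>R x \<in> cball x e"
    by (simp add: dist_norm algebra_simps)
  then have "?f ((1 + c) *\<^sub>R x) \<le> sqrt 2"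
    using e by (intro cross_cap_body_bound) blast
  moreover have "?f ((1 + c) *\<^sub>R x) = (1 + c) * ?f x"
  proof -
    have "(1 + c) *\<^sub>R x - axis i (((1 + c) *\<^sub>R x) $ i) = (1 + c) *\<^sub>R (x - axis i (x $ i))"
      by (simp add: vec_eq_iff axis_def algebra_simps)
    then show ?thesis using c by (simp add: abs_mult distrib_left)
  qed
  ultimately have le: "?f x + c * ?f x \<le> sqrt 2" by (simp add: distrib_right)
  show ?thesis
  proof (cases "?f x = 0")
    case False
    moreover have "0 \<le> ?f x" by simp
    ultimately have "0 < c * ?f x" using c by (intro mult_pos_pos) linarith+
    with le show ?thesis by linarith
  qed simp
qed

lemma cross_vertex_in_frontier:
  assumes "v \<in> cross_vertices"
  shows "v \<in> frontier cross_cap_body"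
proof -
  obtain i s where v: "v = axis i s" "s\<^sup>2 = 2" using assms by (auto simp: cross_vertices_def)
  then have "\<bar>s\<bar> = sqrt 2" by (metis real_sqrt_abs)
  with v have "v \<notin> interior cross_cap_body"
    using interior_cross_cap_body_bound[of v i] by (auto simp: axis_def)
  moreover have "v \<in> cross_cap_body" using assms by (simp add: hull_inc)
  ultimately show ?thesis using closure_subset by (auto simp: frontier_def)
qed

text \<open>Entering the double cone from its apex requires the inward axial component of
  \<open>u\<close> to exceed the norm \<open>n\<close> of the rest; as \<open>u\<close> is a unit
  vector, its square exceeds 1/2.\<close>

lemma illuminates_cross_vertex_imp:
  assumes u: "norm u = 1" and s: "s\<^sup>2 = 2" and ill: "illuminates cross_cap_body u (axis i s)"
  shows "s * u $ i < 0 \<and> 1 < 2 * (u $ i)\<^sup>2"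
proof -
  obtain t where t: "0 < t" "axis i s + t *\<^sub>R u \<in> interior cross_cap_body"
    using ill by (auto simp: illuminates_def)
  define n where "n = norm (u - axis i (u $ i))"
  have n2: "n\<^sup>2 = 1 - (u $ i)\<^sup>2"
  proof -
    have "u \<bullet> u = 1" using u by (simp add: norm_eq_1)
    then show ?thesis unfolding n_def power2_norm_eq_inner
      by (simp add: inner_diff inner_axis inner_axis' inner_axis_axis power2_eq_square)
  qed
  define y where "y = axis i s + t *\<^sub>R u"
  have "y - axis i (y $ i) = t *\<^sub>R (u - axis i (u $ i))"
    by (simp add: y_def vec_eq_iff axis_def)
  moreover have "y $ i = s + t * u $ i" by (simp add: y_def axis_def)
  ultimately have lt: "\<bar>s + t * u $ i\<bar> + t * n < sqrt 2"
    using interior_cross_cap_body_bound[of y i] t by (simp add: n_def y_def)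
  have n: "0 \<le> n" by (simp add: n_def)
  have abs_s: "\<bar>s\<bar> = sqrt 2" using s by (metis real_sqrt_abs)
  have "n < - (sgn s * u $ i)"
  proof -
    have "s \<noteq> 0" using s by auto
    then have "\<bar>s\<bar> + t * (sgn s * u $ i) = sgn s * (s + t * u $ i)"
      by (simp add: algebra_simps abs_sgn)
    also have "\<dots> \<le> \<bar>s + t * u $ i\<bar>" using \<open>s \<noteq> 0\<close> by (auto simp: sgn_if)
    finally have "t * n < t * (- (sgn s * u $ i))" using lt abs_s by simp
    with t show ?thesis by (simp only: mult_less_cancel_left_pos)
  qed
  moreover have "sgn s = 1 \<and> 0 < s \<or> sgn s = -1 \<and> s < 0" using s by (auto simp: sgn_if)
  ultimately have "s * u $ i < 0" "n < \<bar>u $ i\<bar>"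
    using n by (auto simp: mult_less_0_iff)
  then have "n\<^sup>2 < (u $ i)\<^sup>2" using n by (metis abs_of_nonneg abs_le_square_iff not_le)
  with n2 \<open>s * u $ i < 0\<close> show ?thesis by simp
qed

text \<open>Only one coordinate of a unit vector can have square above 1/2, and its sign determines
  the vertex on that axis.\<close>

lemma illuminates_cross_vertex_unique:
  assumes u: "norm u = 1" and vw: "v \<in> cross_vertices" "w \<in> cross_vertices"
    and ill: "illuminates cross_cap_body u v" "illuminates cross_cap_body u w"
  shows "v = w"
proof -
  obtain i s where v: "v = axis i s" "s\<^sup>2 = 2" using vw by (auto simp: cross_vertices_def)
  obtain j t where w: "w = axis j t" "t\<^sup>2 = 2" using vw by (auto simp: cross_vertices_def)
  have iu: "s * u $ i < 0" "1 < 2 * (u $ i)\<^sup>2"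
    using illuminates_cross_vertex_imp[OF u v(2)] ill v by auto
  have ju: "t * u $ j < 0" "1 < 2 * (u $ j)\<^sup>2"
    using illuminates_cross_vertex_imp[OF u w(2)] ill w by auto
  have "i = j"
  proof (rule ccontr)
    assume ne: "i \<noteq> j"
    have "(u $ i)\<^sup>2 + (u $ j)\<^sup>2 = (\<Sum>k\<in>{i, j}. (u $ k)\<^sup>2)" using ne by simp
    also have "\<dots> \<le> (\<Sum>k\<in>UNIV. (u $ k)\<^sup>2)" by (rule sum_mono2) auto
    also have "\<dots> = u \<bullet> u" by (simp add: inner_vec_def power2_eq_square)
    also have "\<dots> = 1" using u by (simp add: norm_eq_1)
    finally show False using iu ju by linarith
  qed
  moreover have "s = t"
  proof (rule ccontr)
    assume "s \<noteq> t"
    with v w have "s = - t" by (metis power2_eq_iff)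
    with iu ju \<open>i = j\<close> show False by simp
  qed
  ultimately show ?thesis using v w by simp
qed

text \<open>By uniqueness, choosing an illuminating direction for each vertex is injective.\<close>

lemma card_illuminating_cross_ge:
  fixes D :: "(real^'n) set"
  assumes D: "finite D" "D \<subseteq> sphere 0 1" "\<forall>p\<in>frontier cross_cap_body. \<exists>u\<in>D. illuminates cross_cap_body u p"
  shows "2 * CARD('n) \<le> card D"
proof -
  have "\<forall>v\<in>cross_vertices. \<exists>u\<in>D. illuminates cross_cap_body u v"
    using D(3) cross_vertex_in_frontier by blast
  then obtain f where f: "\<forall>v\<in>cross_vertices. f v \<in> D \<and> illuminates cross_cap_body (f v) v"
    by metis
  have "inj_on f cross_vertices"
  proof (rule inj_onI)
    fix v w assume "v \<in> cross_vertices" "w \<in> cross_vertices" "f v = f w"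
    moreover from this have "norm (f v) = 1" using f D(2) by auto
    ultimately show "v = w" using f illuminates_cross_vertex_unique[of "f v" v w] by auto
  qed
  then have "card (cross_vertices :: (real^'n) set) \<le> card D"
    using f D(1) by (intro card_inj_on_le) auto
  then show ?thesis by (simp add: card_cross_vertices)
qed

theorem theorem3:
  shows "(\<forall>K :: (real^4) set. cap_body K \<and> unconditionally_symmetric K \<longrightarrow>
            illumination_number K \<le> 8)
       \<and> (\<exists>K :: (real^4) set. cap_body K \<and> unconditionally_symmetric K \<and>
            illumination_number K = 8)"
proof
  show le: "\<forall>K :: (real^4) set. cap_body K \<and> unconditionally_symmetric K \<longrightarrow>
      illumination_number K \<le> 8"
  proof (intro allI impI, elim conjE)
    fix K :: "(real^4) set"
    assume "cap_body K" "unconditionally_symmetric K"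
    then obtain D where "finite D" "card D \<le> 8" "D \<subseteq> sphere 0 1"
      "\<forall>p\<in>frontier K. \<exists>u\<in>D. illuminates K u p"
      by (rule unconditional_cap_body_illuminated)
    then show "illumination_number K \<le> 8"
      using illumination_number_le[of D K] by linarith
  qed
  let ?K = "cross_cap_body :: (real^4) set"
  obtain D where "finite D" "card D \<le> 8" "D \<subseteq> sphere 0 1"
    "\<forall>p\<in>frontier ?K. \<exists>u\<in>D. illuminates ?K u p"
    using cap_body_cross unconditionally_symmetric_cross by (rule unconditional_cap_body_illuminated)
  \<comment> \<open>A minimal illuminating set turns the cardinality bound into a lower bound for
    the illumination number.\<close>
  from this(1,3,4) obtain D' where "finite D'" "card D' = illumination_number ?K" "D' \<subseteq> sphere 0 1"
    "\<forall>p\<in>frontier ?K. \<exists>u\<in>D'. illuminates ?K u p"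
    by (rule illumination_number_attained)
  then have "8 \<le> illumination_number ?K"
    using card_illuminating_cross_ge[of D'] by simp
  moreover have "illumination_number ?K \<le> 8"
    using le cap_body_cross unconditionally_symmetric_cross by blast
  ultimately show "\<exists>K :: (real^4) set. cap_body K \<and> unconditionally_symmetric K \<and>
      illumination_number K = 8"
    using cap_body_cross unconditionally_symmetric_cross by (intro exI[of _ ?K]) auto
qed

end
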